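(* Let $A\in M_{n\times n}(\mathbb{R})$ and $C\in K(\mathbb{R}^n)$. $(1^o)$ $$\min_{1\le j\le n}\lambda_j\Big(\frac{A+A^T}{2}\Big)\leq \underline{\lambda}_C(A)\leq \overline{\lambda}_C(A)\leq \max_{1\le j\le n}\lambda_j\Big(\frac{A+A^T}{2}\Big).$$ $(2^o)$ If $A$ is a normal matrix (i.e. $A^TA=AA^T$), then for every $C\in K(\mathbb{R}^n)$ $$\min_{1\leq j\leq n}\operatorname{Re}\lambda_j(A) \leq \underline{\lambda}_C(A)\leq \overline{\lambda}_C(A) \leq \max_{1\leq j\leq n}\operatorname{Re}\lambda_j(A).$$
   Context: $M_{n\times n}(\mathbb{R})$ is the space of real $n\times n$ matrices; $\lambda_j(B)\in\mathbb{C}$, $j=1,\dots,n$, are the eigenvalues of a matrix $B$ repeated according to multiplicity; $\langle\cdot,\cdot\rangle$ is the standard inner product on $\mathbb{R}^n$. $\overline{K}(\mathbb{R}^n)$ is the set of self-dual solid convex cones in $\mathbb{R}^n$: $\overline{C}\in\overline{K}(\mathbb{R}^n)$ if $\alpha u+\beta w\in\overline{C}$ for all $u,w\in\overline{C}$ and $\alpha,\beta\ge 0$; $\overline{C}=\{u\in\mathbb{R}^n\mid \langle w,u\rangle\ge 0\ \forall w\in\overline{C}\}$; and $C^o:=\operatorname{int}\overline{C}\ne\emptyset$. Put $C:=\overline{C}\setminus\{0\}$ and $K(\mathbb{R}^n):=\{C\mid \overline{C}\in\overline{K}(\mathbb{R}^n)\}$. With $\lambda(u,v):=\frac{\langle Au,v\rangle}{\langle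 u,v\rangle}$ (well defined on $C\times C^o$ and $C^o\times C$), the upper and lower quasi-eigenvalues of $A$ in $C$ are $\overline{\lambda}_C(A):=\sup_{u\in C}\inf_{v\in C^o}\lambda(u,v)$ and $\underline{\lambda}_C(A):=\inf_{v\in C}\sup_{u\in C^o}\lambda(u,v)$. *)

theory Defs
  imports
    "HOL-Analysis.Analysis"
    "HOL-Computational_Algebra.Fundamental_Theorem_Algebra"
begin

section \<open>Eigenvalues of a real matrix\<close>

definition charpoly :: "real^'n^'n \<Rightarrow> complex poly" where
  "charpoly A = det (mat [:0, 1:] - (\<chi> i j. [:complex_of_real (A $ i $ j):]))"

definition eigvals :: "real^'n^'n \<Rightarrow> complex multiset" where
  "eigvals A = proots (charpoly A)"

text \<open>
  Complex numbers carry no order here, so extremal eigenvalues are taken over real parts. For a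
  symmetric matrix nothing is lost: all its eigenvalues are real, see \<open>eigvals_symmetric_real\<close>.
\<close>

definition min_Re_eigval :: "real^'n^'n \<Rightarrow> real" where
  "min_Re_eigval A = Min (Re ` set_mset (eigvals A))"

definition max_Re_eigval :: "real^'n^'n \<Rightarrow> real" where
  "max_Re_eigval A = Max (Re ` set_mset (eigvals A))"


section \<open>Self-dual solid convex cones\<close>

definition closed_cones :: "(real^'n) set set" where
  "closed_cones = {S.
     (\<forall>u\<in>S. \<forall>w\<in>S. \<forall>a\<ge>0. \<forall>b\<ge>0. a *\<^sub>R u + b *\<^sub>R w \<in> S) \<and>
     S = {u. \<forall>w\<in>S. w \<bullet> u \<ge> 0} \<and>
     interior S \<noteq> {}}"

definition cones :: "(real^'n) set set" where
  "cones = {S - {0} | S. S \<in> closed_cones}"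

text \<open>The closed cone belonging to \<open>C \<in> cones\<close> is \<open>insert 0 C\<close>, since \<open>0\<close> lies in every closed cone.\<close>

definition cone_int :: "(real^'n) set \<Rightarrow> (real^'n) set" where
  "cone_int C = interior (insert 0 C)"


section \<open>Quasi-eigenvalues\<close>

definition quasi_quot :: "real^'n^'n \<Rightarrow> real^'n \<Rightarrow> real^'n \<Rightarrow> real" where
  "quasi_quot A u v = ((A *v u) \<bullet> v) / (u \<bullet> v)"

text \<open>
  Extended reals are needed: for \<open>u\<close> on the boundary of the cone the inner infimum (supremum)
  can be infinite.
\<close>

definition upper_quasi_eigval :: "(real^'n) set \<Rightarrow> real^'n^'n \<Rightarrow> ereal" where
  "upper_quasi_eigval C A = (SUP u\<in>C. INF v\<in>cone_int C. ereal (quasi_quot A u v))"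

definition lower_quasi_eigval :: "(real^'n) set \<Rightarrow> real^'n^'n \<Rightarrow> ereal" where
  "lower_quasi_eigval C A = (INF v\<in>C. SUP u\<in>cone_int C. ereal (quasi_quot A u v))"


section \<open>Well-definedness\<close>

lemma degree_charpoly:
  fixes A :: "real^'n^'n"
  shows "degree (charpoly A) = CARD('n)"
proof -
  define M where "M = mat [:0, 1:] - (\<chi> i j. [:complex_of_real (A $ i $ j):])"
  have M: "M $ i $ j = (if i = j then [:- complex_of_real (A $ i $ i), 1:]
                        else [:- complex_of_real (A $ i $ j):])" for i j
    by (simp add: M_def mat_def)
  define P where "P = {p. p permutes (UNIV :: 'n set)}"
  define t where "t = (\<lambda>p. of_int (sign p) * (\<Prod>i\<in>UNIV. M $ i $ p i))"
  have finP: "finite P" by (simp add: P_def finite_permutations)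
  have idP: "id \<in> P" by (simp add: P_def permutes_id)
  have "charpoly A = sum t P"
    by (simp add: charpoly_def det_def M_def[symmetric] t_def P_def)
  also have "\<dots> = t id + sum t (P - {id})"
    by (rule sum.remove[OF finP idP])
  finally have split: "charpoly A = t id + sum t (P - {id})" .
  have deg_id: "degree (t id) = CARD('n)"
    by (simp add: t_def M sign_id degree_prod_eq_sum_degree)
  have deg_p: "degree (t p) < CARD('n)" if "p \<in> P - {id}" for p
  proof -
    have "p \<noteq> id" using that by simp
    then obtain k where k: "p k \<noteq> k" by (auto simp: fun_eq_iff)
    have "degree (t p) \<le> degree (\<Prod>i\<in>UNIV. M $ i $ p i)"
      by (cases rule: sign_cases[of p]) (auto simp: t_def)
    also have "\<dots> \<le> (\<Sum>i\<in>UNIV. degree (M $ i $ p i))"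
      using degree_prod_sum_le[of "UNIV :: 'n set" "\<lambda>i. M $ i $ p i"] by (simp add: o_def)
    also have "\<dots> = (\<Sum>i\<in>UNIV. if i = p i then 1 else 0)"
      by (intro sum.cong) (auto simp: M)
    also have "\<dots> < (\<Sum>i\<in>(UNIV :: 'n set). 1)"
      by (rule sum_strict_mono_ex1) (use k in \<open>auto intro!: exI[of _ k]\<close>)
    finally show ?thesis by simp
  qed
  have "degree (sum t (P - {id})) < CARD('n)"
    by (rule degree_sum_less) (use deg_p in auto)
  then show ?thesis using deg_id split by (simp add: degree_add_eq_left)
qed

lemma size_eigvals:
  fixes A :: "real^'n^'n"
  shows "size (eigvals A) = CARD('n)"
  by (simp add: eigvals_def size_proots_complex degree_charpoly)

lemma eigvals_nonempty:
  fixes A :: "real^'n^'n"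
  shows "eigvals A \<noteq> {#}"
  using size_eigvals[of A] by auto

lemma poly_charpoly:
  fixes A :: "real^'n^'n"
  shows "poly (charpoly A) z = det (mat z - (\<chi> i j. complex_of_real (A $ i $ j)))"
  by (auto simp: charpoly_def det_def poly_sum poly_prod mat_def sign_def intro!: sum.cong prod.cong)

lemma in_eigvals_iff:
  fixes A :: "real^'n^'n"
  shows "z \<in># eigvals A \<longleftrightarrow> (\<exists>x. x \<noteq> 0 \<and> (\<chi> i j. complex_of_real (A $ i $ j)) *v x = z *s x)"
proof -
  let ?M = "mat z - (\<chi> i j. complex_of_real (A $ i $ j)) :: complex^'n^'n"
  have "charpoly A \<noteq> 0" using degree_charpoly[of A] by auto
  then have "z \<in># eigvals A \<longleftrightarrow> det ?M = 0"
    by (simp add: eigvals_def poly_charpoly)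
  also have "\<dots> \<longleftrightarrow> \<not> (\<exists>B. B ** ?M = mat 1)"
    by (metis invertible_det_nz invertible_left_inverse)
  also have "\<dots> \<longleftrightarrow> (\<exists>x. x \<noteq> 0 \<and> ?M *v x = 0)"
    by (auto simp: matrix_left_invertible_ker)
  also have "(\<lambda>x. ?M *v x = 0) = (\<lambda>x. (\<chi> i j. complex_of_real (A $ i $ j)) *v x = z *s x)"
  proof
    fix x :: "complex^'n"
    have "mat z *v x = z *s x"
      by (simp add: vec_eq_iff matrix_vector_mult_def mat_def if_distrib[of "\<lambda>y. y * _"] cong: if_cong)
    then show "(?M *v x = 0) = ((\<chi> i j. complex_of_real (A $ i $ j)) *v x = z *s x)"
      by (auto simp: matrix_vector_mult_diff_rdistrib)
  qed
  finally show ?thesis .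
qed

lemma eigvals_symmetric_real:
  fixes A :: "real^'n^'n"
  assumes sym: "transpose A = A" and z: "z \<in># eigvals A"
  shows "z \<in> \<real>"
proof -
  obtain x where x: "x \<noteq> 0" "(\<chi> i j. complex_of_real (A $ i $ j)) *v x = z *s x"
    using z by (auto simp: in_eigvals_iff)
  have ev: "(\<Sum>j\<in>UNIV. complex_of_real (A $ i $ j) * x $ j) = z * x $ i" for i
    using x(2) by (simp add: vec_eq_iff matrix_vector_mult_def)
  have s: "A $ i $ j = A $ j $ i" for i j
    using sym by (metis transpose_def vec_lambda_beta)
  define N where "N = (\<Sum>i\<in>UNIV. (cmod (x $ i))\<^sup>2)"
  define q where "q = (\<Sum>i\<in>UNIV. cnj (x $ i) * (\<Sum>j\<in>UNIV. complex_of_real (A $ i $ j) * x $ j))"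
  have q: "q = z * of_real N"
    unfolding q_def ev N_def of_real_sum sum_distrib_left complex_norm_square
    by (simp add: mult_ac)
  have "cnj q = (\<Sum>i\<in>UNIV. \<Sum>j\<in>UNIV. x $ i * (complex_of_real (A $ i $ j) * cnj (x $ j)))"
    by (simp add: q_def sum_distrib_left)
  also have "\<dots> = (\<Sum>j\<in>UNIV. \<Sum>i\<in>UNIV. x $ i * (complex_of_real (A $ i $ j) * cnj (x $ j)))"
    by (rule sum.swap)
  also have "\<dots> = q"
    unfolding q_def sum_distrib_left by (intro sum.cong refl) (simp add: s mult_ac)
  finally have "cnj z * of_real N = z * of_real N" by (simp add: q)
  moreover obtain k where "x $ k \<noteq> 0" using x(1) by (auto simp: vec_eq_iff)
  then have "N > 0" unfolding N_def by (intro sum_pos2[of _ k]) auto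
  ultimately have "cnj z = z" by simp
  then show ?thesis by (simp add: Reals_cnj_iff)
qed

lemma closed_cone_of_cone:
  assumes "S \<in> closed_cones"
  shows "insert 0 (S - {0}) = S" "cone_int (S - {0}) = interior S"
proof -
  have "0 \<in> {u. \<forall>w\<in>S. w \<bullet> u \<ge> 0}" by simp
  moreover have "S = {u. \<forall>w\<in>S. w \<bullet> u \<ge> 0}" using assms by (simp add: closed_cones_def)
  ultimately have "0 \<in> S" by blast
  then show "insert 0 (S - {0}) = S" by auto
  then show "cone_int (S - {0}) = interior S" by (simp add: cone_int_def)
qed

lemma inner_cone_pos:
  assumes C: "C \<in> cones" and u: "u \<in> C" and v: "v \<in> cone_int C"
  shows "u \<bullet> v > 0"
proof -
  obtain S where S: "S \<in> closed_cones" and CS: "C = S - {0}"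
    using C by (auto simp: cones_def)
  have vS: "v \<in> interior S" using v S CS closed_cone_of_cone by metis
  have dual: "S = {u. \<forall>w\<in>S. w \<bullet> u \<ge> 0}" using S by (simp add: closed_cones_def)
  have uS: "u \<in> S" "u \<noteq> 0" using u CS by auto
  obtain e where e: "e > 0" "cball v e \<subseteq> S" using vS by (meson mem_interior_cball)
  let ?w = "v - (e / norm u) *\<^sub>R u"
  have "?w \<in> cball v e" using uS e by (simp add: dist_norm)
  then have "?w \<in> S" using e by blast
  then have "u \<bullet> ?w \<ge> 0" using dual uS by blast
  then have "u \<bullet> v \<ge> (e / norm u) * (u \<bullet> u)" by (simp add: inner_diff_right)
  moreover have "(e / norm u) * (u \<bullet> u) > 0" using e uS by simp
  ultimately show ?thesis by linarith
qed

end

theory Submission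
  imports Defs
begin

text \<open>
  For the outer bounds, perturb \<open>u \<in> C\<close> to \<open>u + \<epsilon> e\<close> with \<open>e\<close> in the interior of the cone: as
  \<open>\<epsilon> \<rightarrow> 0\<close> the quasi-quotient of \<open>u\<close> and \<open>u + \<epsilon> e\<close> tends to the Rayleigh quotient of \<open>u\<close>.
  For a normal matrix the maximal Rayleigh quotient is the real part of an eigenvalue: the top
  eigenspace of the symmetric part is invariant under the skew part, which has an
  eigenvector there. The symmetric part is itself normal, so this covers both claims.

  The middle inequality is a theorem of the alternative. If \<open>t\<close> exceeds the upper quasi-eigenvalue,
  then \<open>B = A - t\<close> maps no nonzero vector of the closed cone into the cone; separating the image
  under \<open>B\<close> of a compact base of the cone from the cone gives a vector \<open>v \<noteq> 0\<close> of the cone such that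
  \<open>- B\<^sup>T v\<close> lies in the cone, so \<open>t\<close> is at least the lower quasi-eigenvalue.
\<close>

section \<open>Rayleigh quotients of normal matrices\<close>

text \<open>A maximiser of the Rayleigh quotient on the unit sphere of \<open>E\<close> is an
  eigenvector, because the gradient must vanish there. The subspace version allows a second use on
  an eigenspace found by the first.\<close>

lemma selfadjoint_max_eigenvector:
  fixes f :: "'a::euclidean_space \<Rightarrow> 'a"
  assumes lin: "linear f" and adj: "\<And>x y. f x \<bullet> y = x \<bullet> f y"
    and E: "subspace E" "\<And>x. x \<in> E \<Longrightarrow> f x \<in> E" "e \<in> E" "e \<noteq> 0"
  obtains m x where "x \<in> E" "x \<noteq> 0" "f x = m *\<^sub>R x" "\<And>y. y \<in> E \<Longrightarrow> f y \<bullet> y \<le> m * (y \<bullet> y)"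
proof -
  let ?K = "E \<inter> sphere 0 1"
  have "compact ?K" using closed_subspace[OF E(1)] by (simp add: closed_Int_compact)
  moreover have "(1 / norm e) *\<^sub>R e \<in> ?K" using E by (simp add: subspace_scale)
  then have "?K \<noteq> {}" by blast
  moreover have "continuous_on ?K (\<lambda>x. f x \<bullet> x)"
    by (intro continuous_intros linear_continuous_on linear_conv_bounded_linear[THEN iffD1] lin)
  ultimately obtain x where x: "x \<in> ?K" and max: "\<And>y. y \<in> ?K \<Longrightarrow> f y \<bullet> y \<le> f x \<bullet> x"
    using continuous_attains_sup[of ?K "\<lambda>x. f x \<bullet> x"] by blast
  define m where "m = f x \<bullet> x"
  have xx: "x \<bullet> x = 1" using x by (simp add: dot_square_norm)
  have bound: "f y \<bullet> y \<le> m * (y \<bullet> y)" if y: "y \<in> E" for y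
  proof (cases "y = 0")
    case False
    have "(1 / norm y) *\<^sub>R y \<in> ?K" using y E False by (simp add: subspace_scale)
    from max[OF this] have "(f y \<bullet> y) / (norm y)\<^sup>2 \<le> m"
      by (simp add: m_def linear_scale[OF lin] power2_eq_square)
    then show ?thesis using False by (simp add: dot_square_norm field_simps)
  qed (simp add: linear_0[OF lin])
  \<comment> \<open>Up to a factor 2, \<open>w\<close> is the gradient at \<open>x\<close> of the
    function sending \<open>y\<close> to \<open>m * (y \<bullet> y) - f y \<bullet> y\<close>, which
    is nonnegative on \<open>E\<close> and zero at \<open>x\<close>.\<close>
  define w where "w = m *\<^sub>R x - f x"
  have wE: "w \<in> E" using x E by (simp add: w_def subspace_diff subspace_scale)
  define q where "q = m * (w \<bullet> w) - f w \<bullet> w"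
  have q0: "q \<ge> 0" using bound[OF wE] by (simp add: q_def)
  have quad: "0 \<le> 2 * t * (w \<bullet> w) + t\<^sup>2 * q" for t
  proof -
    have "x + t *\<^sub>R w \<in> E" using x wE E by (simp add: subspace_add subspace_scale)
    from bound[OF this] have "0 \<le> m * ((x + t *\<^sub>R w) \<bullet> (x + t *\<^sub>R w)) - f (x + t *\<^sub>R w) \<bullet> (x + t *\<^sub>R w)"
      by simp
    also have "\<dots> = (m * (x \<bullet> x) - f x \<bullet> x) + 2 * t * (m * (x \<bullet> w) - f x \<bullet> w) + t\<^sup>2 * q"
      using adj[of w x]
      by (simp add: linear_add[OF lin] linear_scale[OF lin] inner_add_left inner_add_right q_def
          power2_eq_square inner_commute algebra_simps)
    also have "m * (x \<bullet> w) - f x \<bullet> w = w \<bullet> w" by (simp add: w_def inner_diff_left)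
    finally show ?thesis by (simp add: xx m_def)
  qed
  define n where "n = w \<bullet> w"
  \<comment> \<open>The quadratic is minimal at \<open>- n / q\<close>; the denominator
    \<open>q + 1\<close> also covers \<open>q = 0\<close> and still makes the value negative unless
    \<open>n = 0\<close>.\<close>
  have "0 \<le> 2 * (- n / (q + 1)) * n + (- n / (q + 1))\<^sup>2 * q" using quad unfolding n_def .
  also have "\<dots> = n\<^sup>2 * (- q - 2) / (q + 1)\<^sup>2"
    using q0 by (simp add: divide_simps power2_eq_square) (simp add: algebra_simps)
  finally have "0 \<le> n\<^sup>2 * (- q - 2)" using q0 by (simp add: zero_le_divide_iff)
  then have "n = 0" using q0 by (simp add: zero_le_mult_iff)
  then have "f x = m *\<^sub>R x" by (simp add: w_def n_def)
  moreover have "x \<noteq> 0" using xx by auto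
  ultimately show thesis using that[of x m] x bound by blast
qed

lemma matrix_vector_inner_transpose:
  fixes A :: "real^'n^'m"
  shows "(A *v x) \<bullet> y = x \<bullet> (transpose A *v y)"
  by (metis dot_lmul_matrix inner_commute transpose_matrix_vector)

text \<open>The hypotheses are the real and imaginary parts of the eigenvalue equation for the
  vector \<open>a + i b\<close> with eigenvalue \<open>m + i s\<close>.\<close>

lemma eigvals_of_real_pair:
  fixes A :: "real^'n^'n"
  assumes a: "A *v a = m *\<^sub>R a - s *\<^sub>R b" and b: "A *v b = s *\<^sub>R a + m *\<^sub>R b"
    and nz: "a \<noteq> 0 \<or> b \<noteq> 0"
  shows "Complex m s \<in># eigvals A"
proof -
  define x :: "complex^'n" where "x = (\<chi> i. Complex (a $ i) (b $ i))"
  have "x \<noteq> 0" using nz by (auto simp: x_def vec_eq_iff complex_eq_iff)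
  moreover have "(\<Sum>j\<in>UNIV. A $ i $ j * a $ j) = m * a $ i - s * b $ i"
    and "(\<Sum>j\<in>UNIV. A $ i $ j * b $ j) = s * a $ i + m * b $ i" for i
    using a b by (simp_all add: vec_eq_iff matrix_vector_mult_def)
  then have "(\<chi> i j. complex_of_real (A $ i $ j)) *v x = Complex m s *s x"
    by (simp add: x_def vec_eq_iff matrix_vector_mult_def complex_eq_iff algebra_simps)
  ultimately show ?thesis by (auto simp: in_eigvals_iff)
qed

text \<open>Normality makes the symmetric part \<open>H\<close> and the skew part \<open>K\<close>
  commute. The form of \<open>A\<close> is that of \<open>H\<close>, so its maximal Rayleigh
  quotient is the top eigenvalue \<open>m\<close> of \<open>H\<close>; inside that eigenspace
  \<open>K\<close> only adds an imaginary part.\<close>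

lemma normal_max_eigval:
  fixes A :: "real^'n^'n"
  assumes normal: "transpose A ** A = A ** transpose A"
  obtains z where "z \<in># eigvals A" "\<And>x. (A *v x) \<bullet> x \<le> Re z * (x \<bullet> x)"
proof -
  let ?T = "transpose A"
  note [simp del] = transpose_matrix_vector
  note mv = matrix_vector_right_distrib matrix_vector_mult_diff_distrib
    matrix_vector_mult_scaleR
  have comm: "?T *v (A *v x) = A *v (?T *v x)" for x
    by (simp only: matrix_vector_mul_assoc normal)
  have inner_T: "(?T *v x) \<bullet> y = x \<bullet> (A *v y)" for x y
    by (metis matrix_vector_inner_transpose transpose_transpose)
  define H where "H = (\<lambda>x. (1/2) *\<^sub>R (A *v x + ?T *v x))"
  define K where "K = (\<lambda>x. (1/2) *\<^sub>R (A *v x - ?T *v x))"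
  have linH: "linear H" and linK: "linear K"
    by (rule linearI; simp add: H_def K_def mv algebra_simps)+
  have A_eq: "A *v x = H x + K x" for x
    by (simp add: H_def K_def algebra_simps flip: scaleR_add_left)
  have HK: "H (K x) = K (H x)" for x
    by (simp add: H_def K_def mv comm algebra_simps)
  have adjH: "H x \<bullet> y = x \<bullet> H y" and skewK: "K x \<bullet> y = - (x \<bullet> K y)" for x y
    by (simp_all add: H_def K_def inner_T matrix_vector_inner_transpose algebra_simps)
  obtain e :: "real^'n" where "e \<noteq> 0" using nonzero_Basis SOME_Basis by blast
  then obtain m x where x: "x \<noteq> 0" "H x = m *\<^sub>R x" and max: "\<And>y. H y \<bullet> y \<le> m * (y \<bullet> y)"
    using selfadjoint_max_eigenvector[OF linH adjH subspace_UNIV UNIV_I UNIV_I] UNIV_I by metis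
  define E where "E = {x. H x = m *\<^sub>R x}"
  have sub: "subspace E"
    by (auto simp: E_def subspace_def linear_0[OF linH] linear_add[OF linH] linear_scale[OF linH]
        scaleR_add_right)
  have KE: "K x \<in> E" if "x \<in> E" for x
    using that by (simp add: E_def HK linear_scale[OF linK])
  \<comment> \<open>A skew map may have no real eigenvector, but minus its square is self-adjoint,
    so the maximisation argument applies to it on \<open>E\<close>.\<close>
  have "linear (\<lambda>x. - K (K x))"
    using linear_compose_neg[OF linear_compose[OF linK linK]] by (simp add: o_def)
  moreover have "(- K (K x)) \<bullet> y = x \<bullet> (- K (K y))" for x y by (simp add: skewK)
  moreover have "- K (K x) \<in> E" if "x \<in> E" for x using that by (simp add: KE sub subspace_neg)
  moreover have "x \<in> E" using x by (simp add: E_def)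
  ultimately obtain r y where y: "y \<in> E" "y \<noteq> 0" "- K (K y) = r *\<^sub>R y"
    using selfadjoint_max_eigenvector[of "\<lambda>x. - K (K x)" E x] sub x(1) by metis
  have Hy: "H y = m *\<^sub>R y" and HKy: "H (K y) = m *\<^sub>R K y"
    using y KE[of y] by (simp_all add: E_def)
  have KKy: "K (K y) = - (r *\<^sub>R y)" using y(3) by (metis minus_equation_iff)
  have r: "K y \<bullet> K y = r * (y \<bullet> y)" by (simp add: skewK[of y] KKy)
  moreover have "y \<bullet> y > 0" using y(2) by simp
  ultimately have "r \<ge> 0" by (metis inner_ge_zero not_less zero_le_mult_iff)
  define s where "s = sqrt r"
  have s2: "s * s = r" using \<open>r \<ge> 0\<close> by (simp add: s_def)
  \<comment> \<open>The real pair is \<open>K y\<close> and \<open>s *\<^sub>R y\<close>. Both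
    vanish when \<open>s = 0\<close>; then \<open>y\<close> itself is a real eigenvector of
    \<open>A\<close>.\<close>
  have "Complex m s \<in># eigvals A"
  proof (cases "s = 0")
    case True
    then have "K y = 0" using r s2 by simp
    then show ?thesis using eigvals_of_real_pair[of A y m s 0] True y(2) by (simp add: A_eq Hy)
  next
    case False
    then show ?thesis
      using eigvals_of_real_pair[of A "K y" m s "s *\<^sub>R y"] y(2)
      by (simp add: A_eq Hy HKy KKy s2 linear_scale[OF linH] linear_scale[OF linK] algebra_simps)
  qed
  moreover have "(A *v y) \<bullet> y \<le> m * (y \<bullet> y)" for y
  proof -
    have "K y \<bullet> y = 0" using skewK[of y y] by (simp add: inner_commute)
    then show ?thesis using max[of y] by (simp add: A_eq inner_add_left)
  qed
  ultimately show thesis using that by simp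
qed

lemma eigvals_uminus:
  fixes A :: "real^'n^'n"
  assumes "z \<in># eigvals (- A)"
  shows "- z \<in># eigvals A"
proof -
  obtain x where "x \<noteq> 0" "(\<chi> i j. complex_of_real ((- A) $ i $ j)) *v x = z *s x"
    using assms by (auto simp: in_eigvals_iff)
  then have "(\<chi> i j. complex_of_real (A $ i $ j)) *v x = (- z) *s x"
    by (simp add: vec_eq_iff matrix_vector_mult_def sum_negf) (metis minus_minus)
  with \<open>x \<noteq> 0\<close> show ?thesis by (auto simp: in_eigvals_iff)
qed

lemma normal_rayleigh_le_max_Re_eigval:
  fixes A :: "real^'n^'n"
  assumes "transpose A ** A = A ** transpose A"
  shows "(A *v x) \<bullet> x \<le> max_Re_eigval A * (x \<bullet> x)"
proof -
  obtain z where z: "z \<in># eigvals A" "(A *v x) \<bullet> x \<le> Re z * (x \<bullet> x)"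
    using normal_max_eigval[OF assms] by metis
  have "Re z \<le> max_Re_eigval A" using z(1) by (simp add: max_Re_eigval_def)
  then show ?thesis using z(2) mult_right_mono[of "Re z" _ "x \<bullet> x"] by fastforce
qed

lemma normal_min_Re_eigval_le_rayleigh:
  fixes A :: "real^'n^'n"
  assumes "transpose A ** A = A ** transpose A"
  shows "min_Re_eigval A * (x \<bullet> x) \<le> (A *v x) \<bullet> x"
proof -
  have neg: "(- A) *v y = - (A *v y)" for y
    by (simp add: vec_eq_iff matrix_vector_mult_def sum_negf)
  \<comment> \<open>Negation preserves normality and turns the lower bound into the upper
    one.\<close>
  have "transpose (- A) ** (- A) = (- A) ** transpose (- A)"
    using assms by (simp add: matrix_matrix_mult_def transpose_def vec_eq_iff)
  then obtain z where z: "z \<in># eigvals (- A)" "((- A) *v x) \<bullet> x \<le> Re z * (x \<bullet> x)"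
    using normal_max_eigval by metis
  have "min_Re_eigval A \<le> Re (- z)"
    unfolding min_Re_eigval_def by (intro Min_le imageI eigvals_uminus z(1)) simp
  then have "min_Re_eigval A * (x \<bullet> x) \<le> Re (- z) * (x \<bullet> x)" by (intro mult_right_mono) auto
  then show ?thesis using z(2) by (simp add: neg)
qed

section \<open>Quasi-eigenvalues of a self-dual cone\<close>

text \<open>If the ball of radius \<open>d\<close> about \<open>e\<close> lies in the cone, then
  scaling by \<open>\<epsilon>\<close> and adding \<open>u\<close> gives a ball of radius
  \<open>\<epsilon> * d\<close> about \<open>u + \<epsilon> *\<^sub>R e\<close> that stays in the
  cone.\<close>

lemma cone_perturbation:
  assumes C: "C \<in> cones" and u: "u \<in> C"
  obtains e where "\<And>\<epsilon>. 0 < \<epsilon> \<Longrightarrow> u + \<epsilon> *\<^sub>R e \<in> cone_int C"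
proof -
  obtain S where S: "S \<in> closed_cones" and CS: "C = S - {0}"
    using C by (auto simp: cones_def)
  have comb: "a *\<^sub>R x + b *\<^sub>R y \<in> S" if "x \<in> S" "y \<in> S" "a \<ge> 0" "b \<ge> 0" for a b x y
    using S that by (simp add: closed_cones_def)
  have int: "cone_int C = interior S" using closed_cone_of_cone[OF S] CS by simp
  obtain e where e: "e \<in> interior S" using S by (auto simp: closed_cones_def)
  then obtain d where d: "d > 0" "cball e d \<subseteq> S" by (meson mem_interior_cball)
  have "u + \<epsilon> *\<^sub>R e \<in> interior S" if "\<epsilon> > 0" for \<epsilon>
    unfolding mem_interior_cball
  proof (intro exI conjI subsetI)
    show "\<epsilon> * d > 0" using d that by simp
    fix y assume "y \<in> cball (u + \<epsilon> *\<^sub>R e) (\<epsilon> * d)"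
    then have y: "norm (u + \<epsilon> *\<^sub>R e - y) \<le> \<epsilon> * d" by (simp add: dist_norm)
    define y' where "y' = (1/\<epsilon>) *\<^sub>R (y - u)"
    have "e - y' = (1/\<epsilon>) *\<^sub>R (u + \<epsilon> *\<^sub>R e - y)" using that by (simp add: y'_def algebra_simps)
    then have "norm (e - y') = norm (u + \<epsilon> *\<^sub>R e - y) / \<epsilon>" using that by simp
    then have "y' \<in> cball e d" using y that by (simp add: dist_norm divide_le_eq mult.commute)
    moreover have "y = 1 *\<^sub>R u + \<epsilon> *\<^sub>R y'" using that by (simp add: y'_def)
    ultimately show "y \<in> S" using comb[of u y' 1 \<epsilon>] d u CS that by auto
  qed
  then show thesis by (intro that) (simp add: int)
qed

section \<open>Outer bounds from Rayleigh quotients\<close>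

lemma upper_quasi_eigval_le:
  fixes A :: "real^'n^'n"
  assumes C: "C \<in> cones" and R: "\<And>u. (A *v u) \<bullet> u \<le> M * (u \<bullet> u)"
  shows "upper_quasi_eigval C A \<le> ereal M"
  unfolding upper_quasi_eigval_def
proof (rule SUP_least)
  fix u assume u: "u \<in> C"
  then have uu: "u \<bullet> u > 0" using C by (auto simp: cones_def)
  obtain e where e: "\<And>\<epsilon>. 0 < \<epsilon> \<Longrightarrow> u + \<epsilon> *\<^sub>R e \<in> cone_int C" using cone_perturbation[OF C u] by blast
  \<comment> \<open>The choice \<open>v = u\<close> is not admissible when \<open>u\<close> is a
    boundary vector, so it is reached as a limit of interior vectors.\<close>
  have "((\<lambda>\<epsilon>. quasi_quot A u (u + \<epsilon> *\<^sub>R e)) \<longlongrightarrow> quasi_quot A u (u + 0 *\<^sub>R e)) (at_right 0)"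
    unfolding quasi_quot_def using uu by (intro tendsto_intros) auto
  then have lim: "((\<lambda>\<epsilon>. ereal (quasi_quot A u (u + \<epsilon> *\<^sub>R e))) \<longlongrightarrow> ereal (quasi_quot A u u)) (at_right 0)"
    by simp
  have "(INF v\<in>cone_int C. ereal (quasi_quot A u v)) \<le> ereal (quasi_quot A u u)"
    by (rule tendsto_lowerbound[OF lim])
      (auto intro!: eventually_at_right_less[THEN eventually_mono] INF_lower e)
  also have "\<dots> \<le> ereal M" using R[of u] uu by (simp add: quasi_quot_def divide_le_eq)
  finally show "(INF v\<in>cone_int C. ereal (quasi_quot A u v)) \<le> ereal M" .
qed

lemma lower_quasi_eigval_ge:
  fixes A :: "real^'n^'n"
  assumes C: "C \<in> cones" and R: "\<And>u. m * (u \<bullet> u) \<le> (A *v u) \<bullet> u"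
  shows "ereal m \<le> lower_quasi_eigval C A"
  unfolding lower_quasi_eigval_def
proof (rule INF_greatest)
  fix v assume v: "v \<in> C"
  then have vv: "v \<bullet> v > 0" using C by (auto simp: cones_def)
  obtain e where e: "\<And>\<epsilon>. 0 < \<epsilon> \<Longrightarrow> v + \<epsilon> *\<^sub>R e \<in> cone_int C" using cone_perturbation[OF C v] by blast
  have "((\<lambda>\<epsilon>. quasi_quot A (v + \<epsilon> *\<^sub>R e) v) \<longlongrightarrow> quasi_quot A (v + 0 *\<^sub>R e) v) (at_right 0)"
    unfolding quasi_quot_def matrix_vector_right_distrib matrix_vector_mult_scaleR
    using vv by (intro tendsto_intros) auto
  then have lim: "((\<lambda>\<epsilon>. ereal (quasi_quot A (v + \<epsilon> *\<^sub>R e) v)) \<longlongrightarrow> ereal (quasi_quot A v v)) (at_right 0)"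
    by simp
  have "ereal m \<le> ereal (quasi_quot A v v)" using R[of v] vv by (simp add: quasi_quot_def le_divide_eq)
  also have "\<dots> \<le> (SUP u\<in>cone_int C. ereal (quasi_quot A u v))"
    by (rule tendsto_upperbound[OF lim])
      (auto intro!: eventually_at_right_less[THEN eventually_mono] SUP_upper e)
  finally show "ereal m \<le> (SUP u\<in>cone_int C. ereal (quasi_quot A u v))" .
qed

section \<open>Theorem of the alternative and the middle inequality\<close>

lemma closed_cones_alternative:
  fixes B :: "real^'n^'n"
  assumes S: "S \<in> closed_cones" and no: "\<And>u. u \<in> S \<Longrightarrow> u \<noteq> 0 \<Longrightarrow> B *v u \<notin> S"
  obtains v where "v \<in> S" "v \<noteq> 0" "\<And>u. u \<in> S \<Longrightarrow> (B *v u) \<bullet> v \<le> 0"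
proof -
  have comb: "a *\<^sub>R x + b *\<^sub>R y \<in> S" if "x \<in> S" "y \<in> S" "a \<ge> 0" "b \<ge> 0" for a b x y
    using S that by (simp add: closed_cones_def)
  have scale: "a *\<^sub>R x \<in> S" if "x \<in> S" "a \<ge> 0" for a x using comb[of x x a 0] that by simp
  have dual: "S = {u. \<forall>w\<in>S. w \<bullet> u \<ge> 0}" using S by (simp add: closed_cones_def)
  have zero: "0 \<in> S" by (subst dual) simp
  have closed: "closed S"
  proof -
    have "S = (\<Inter>w\<in>S. {u. w \<bullet> u \<ge> 0})" by (subst (1) dual) auto
    moreover have "closed (\<Inter>w\<in>S. {u. w \<bullet> u \<ge> 0})" by (intro closed_INT ballI closed_halfspace_ge)
    ultimately show ?thesis by simp
  qed
  have convex: "convex S" by (auto simp: convex_def intro: comb)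
  obtain e d where d: "d > 0" and ball: "cball e d \<subseteq> S"
    using S by (auto simp: closed_cones_def mem_interior_cball)
  \<comment> \<open>Moving from \<open>e\<close> by \<open>d\<close> against the direction of
    \<open>u\<close> stays in \<open>S\<close>; pairing with \<open>u\<close> then gives a bound
    that keeps the base \<open>K\<close> of the cone bounded.\<close>
  have lower: "d * norm u \<le> e \<bullet> u" if "u \<in> S" for u
  proof (cases "u = 0")
    case False
    have "e - (d / norm u) *\<^sub>R u \<in> S" using ball d False by (auto simp: dist_norm)
    then have "0 \<le> (e - (d / norm u) *\<^sub>R u) \<bullet> u" using dual that by blast
    then show ?thesis using False
      by (simp add: inner_diff_left dot_square_norm power2_eq_square)
  qed simp
  define K where "K = S \<inter> {u. e \<bullet> u = 1}"
  have "compact K"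
    unfolding compact_eq_bounded_closed
  proof
    have "norm u \<le> 1 / d" if "u \<in> K" for u
      using lower[of u] that d by (simp add: K_def field_simps)
    then show "bounded K" unfolding bounded_iff by blast
    show "closed K" unfolding K_def by (intro closed_Int closed closed_hyperplane)
  qed
  have "linear ((*v) B)" by simp
  have "compact ((*v) B ` K)"
    by (intro compact_continuous_image \<open>compact K\<close> continuous_intros linear_continuous_on
        linear_conv_bounded_linear[THEN iffD1] \<open>linear ((*v) B)\<close>)
  moreover have "convex ((*v) B ` K)"
    unfolding K_def by (intro convex_linear_image convex_Int convex convex_hyperplane) simp
  moreover have "S \<inter> (*v) B ` K = {}" using no by (force simp: K_def)
  moreover have base: "(1 / (e \<bullet> u)) *\<^sub>R u \<in> K" "e \<bullet> u > 0" if "u \<in> S" "u \<noteq> 0" for u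
  proof -
    show "e \<bullet> u > 0" using lower[OF that(1)] d that(2) by (smt (verit) mult_pos_pos zero_less_norm_iff)
    then show "(1 / (e \<bullet> u)) *\<^sub>R u \<in> K" using that by (simp add: K_def scale)
  qed
  \<comment> \<open>A nonzero vector of \<open>S\<close> makes \<open>K\<close> nonempty and later
    forces \<open>w \<noteq> 0\<close>. The second candidate settles the case
    \<open>e = 0\<close>.\<close>
  obtain k where "k \<in> S" "k \<noteq> 0"
  proof -
    have "e \<in> S" using ball d by auto
    obtain b :: "real^'n" where b: "b \<in> Basis" using SOME_Basis by blast
    have "e + d *\<^sub>R b \<in> S" using ball d b by (auto simp: dist_norm)
    with \<open>e \<in> S\<close> show thesis using that[of e] that[of "e + d *\<^sub>R b"] d b
      by (cases "e = 0") (auto simp: nonzero_Basis)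
  qed
  then have "(*v) B ` K \<noteq> {}" using base(1)[of k] by blast
  ultimately obtain w c where w: "\<And>s. s \<in> S \<Longrightarrow> c < w \<bullet> s" and wB: "\<And>u. u \<in> K \<Longrightarrow> w \<bullet> (B *v u) < c"
    using separating_hyperplane_compact_closed[of "(*v) B ` K" S] closed convex zero by blast
  have c: "c < 0" using w[OF zero] by simp
  have pos: "0 \<le> s \<bullet> w" if s: "s \<in> S" for s
  proof (rule ccontr)
    assume "\<not> 0 \<le> s \<bullet> w"
    then have neg: "w \<bullet> s < 0" by (simp add: inner_commute)
    \<comment> \<open>The positive factor \<open>c / (w \<bullet> s)\<close> moves \<open>s\<close>
      onto the separating hyperplane itself, which strict separation forbids.\<close>
    then have "c < w \<bullet> ((c / (w \<bullet> s)) *\<^sub>R s)"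
      using c by (intro w scale s) (simp add: zero_le_divide_iff)
    then show False using neg by simp
  qed
  have "w \<in> S" by (subst dual) (simp add: pos)
  moreover have "w \<noteq> 0" using wB[OF base(1)[OF \<open>k \<in> S\<close> \<open>k \<noteq> 0\<close>]] c by auto
  moreover have "(B *v u) \<bullet> w \<le> 0" if u: "u \<in> S" for u
  proof (cases "u = 0")
    case False
    have "w \<bullet> (B *v ((1 / (e \<bullet> u)) *\<^sub>R u)) < 0" using wB[OF base(1)[OF u False]] c by simp
    then show ?thesis using base(2)[OF u False]
      by (simp add: matrix_vector_mult_scaleR divide_less_0_iff inner_commute)
  qed simp
  ultimately show thesis using that by blast
qed

lemma lower_le_upper_quasi_eigval:
  fixes A :: "real^'n^'n"
  assumes C: "C \<in> cones"
  shows "lower_quasi_eigval C A \<le> upper_quasi_eigval C A"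
proof (rule ccontr)
  assume "\<not> ?thesis"
  then obtain t where t: "upper_quasi_eigval C A < ereal t" "ereal t < lower_quasi_eigval C A"
    using ereal_dense2 by (metis not_le)
  obtain S where S: "S \<in> closed_cones" and CS: "C = S - {0}"
    using C by (auto simp: cones_def)
  have int: "cone_int C = interior S" using closed_cone_of_cone[OF S] CS by simp
  have dual: "S = {u. \<forall>w\<in>S. w \<bullet> u \<ge> 0}" using S by (simp add: closed_cones_def)
  \<comment> \<open>The sign of \<open>(B *v u) \<bullet> v\<close> compares the quasi-quotient with
    \<open>t\<close>, since \<open>u \<bullet> v > 0\<close> whenever one vector is in
    \<open>C\<close> and the other in its interior.\<close>
  define B where "B = A - t *\<^sub>R mat 1"
  have B: "B *v u = A *v u - t *\<^sub>R u" for u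
    by (simp add: B_def matrix_vector_mult_diff_rdistrib flip: scaleR_matrix_vector_assoc)
  have "B *v u \<notin> S" if u: "u \<in> S" "u \<noteq> 0" for u
  proof
    assume BuS: "B *v u \<in> S"
    have "ereal t \<le> (INF v\<in>cone_int C. ereal (quasi_quot A u v))"
    proof (rule INF_greatest)
      fix v assume v: "v \<in> cone_int C"
      have "u \<bullet> v > 0" using inner_cone_pos[OF C _ v] u CS by simp
      moreover have "v \<in> S" using v int interior_subset by blast
      then have "0 \<le> (B *v u) \<bullet> v" using dual BuS by blast
      ultimately show "ereal t \<le> ereal (quasi_quot A u v)"
        by (simp add: B quasi_quot_def le_divide_eq inner_diff_left)
    qed
    also have "\<dots> \<le> upper_quasi_eigval C A"
      unfolding upper_quasi_eigval_def using u CS by (intro SUP_upper) simp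
    finally show False using t(1) by simp
  qed
  then obtain v where v: "v \<in> S" "v \<noteq> 0" and Bv: "\<And>u. u \<in> S \<Longrightarrow> (B *v u) \<bullet> v \<le> 0"
    using closed_cones_alternative[OF S] by metis
  have vC: "v \<in> C" using v CS by simp
  then have "lower_quasi_eigval C A \<le> (SUP u\<in>cone_int C. ereal (quasi_quot A u v))"
    unfolding lower_quasi_eigval_def by (rule INF_lower)
  also have "\<dots> \<le> ereal t"
  proof (rule SUP_least)
    fix u assume u: "u \<in> cone_int C"
    have "u \<bullet> v > 0" using inner_cone_pos[OF C vC u] by (simp add: inner_commute)
    moreover have "(B *v u) \<bullet> v \<le> 0" using Bv u int interior_subset by blast
    ultimately show "ereal (quasi_quot A u v) \<le> ereal t"
      by (simp add: B quasi_quot_def divide_le_eq inner_diff_left)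
  qed
  finally show False using t(2) by simp
qed

theorem theorem1p4:
  fixes A :: "real^'n^'n" and C :: "(real^'n) set"
  assumes "C \<in> cones"
  shows "(ereal (min_Re_eigval ((1/2) *\<^sub>R (A + transpose A))) \<le> lower_quasi_eigval C A \<and>
          lower_quasi_eigval C A \<le> upper_quasi_eigval C A \<and>
          upper_quasi_eigval C A \<le> ereal (max_Re_eigval ((1/2) *\<^sub>R (A + transpose A)))) \<and>
         (transpose A ** A = A ** transpose A \<longrightarrow>
          (\<forall>D\<in>cones.
            ereal (min_Re_eigval A) \<le> lower_quasi_eigval D A \<and>
            lower_quasi_eigval D A \<le> upper_quasi_eigval D A \<and>
            upper_quasi_eigval D A \<le> ereal (max_Re_eigval A)))"
proof -
  define H where "H = (1/2) *\<^sub>R (A + transpose A)"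
  have "transpose H = H" by (simp add: H_def transpose_def vec_eq_iff)
  then have normal: "transpose H ** H = H ** transpose H" by simp
  \<comment> \<open>The Rayleigh bounds for \<open>H\<close> are thereby bounds for
    \<open>A\<close>, so the same two estimates serve both claims.\<close>
  have H: "(H *v x) \<bullet> x = (A *v x) \<bullet> x" for x
  proof -
    have "(transpose A *v x) \<bullet> x = (A *v x) \<bullet> x"
      by (metis matrix_vector_inner_transpose inner_commute transpose_transpose)
    then show ?thesis
      by (simp add: H_def matrix_vector_mult_add_rdistrib inner_add_left flip: scaleR_matrix_vector_assoc)
  qed
  show ?thesis
    using lower_quasi_eigval_ge[OF assms normal_min_Re_eigval_le_rayleigh[OF normal, unfolded H]]
      upper_quasi_eigval_le[OF assms normal_rayleigh_le_max_Re_eigval[OF normal, unfolded H]]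
      lower_le_upper_quasi_eigval
      lower_quasi_eigval_ge[OF _ normal_min_Re_eigval_le_rayleigh]
      upper_quasi_eigval_le[OF _ normal_rayleigh_le_max_Re_eigval]
      assms
    unfolding H_def by blast
qed

end
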